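(* Let $(F_n)$ be the Fibonacci sequence ($F_0=0$, $F_1=F_2=1$, $F_{n+2}=F_{n+1}+F_n$). The sequence $(F_{n^2})_{n\ge1}$ is not realizable, but the sequence $(5F_{n^2})_{n\ge1}$ is realizable.
   Context: An integer sequence $(U_n)_{n\in\mathbb{N}}$ (with $\mathbb{N}=\{1,2,3,\dots\}$) is called realizable if there exist a set $X$ and a map $T\colon X\to X$ such that the number of points $x\in X$ with $T^n(x)=x$ equals $U_n$ for every $n\ge1$. Equivalently, for every $n\in\mathbb{N}$ the quantity $\sum_{d\mid n}\mu(n/d)U_d$ (with $\mu$ the Möbius function) is non-negative and divisible by $n$. *)

theory Defs
  imports "HOL-Number_Theory.Fib" "HOL-Library.FuncSet"
begin

text \<open>
  HOL cannot quantify existentially over types, so the type in which the set \<open>X\<close> lives is a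
  parameter: a sequence is realizable iff the predicate holds for some type \<open>'a\<close>, and it is not
  realizable iff the predicate fails for every type \<open>'a\<close>. Finiteness is required explicitly
  because \<^term>\<open>card\<close> is 0 on infinite sets. Sequences are indexed from 1; the value of
  \<open>U\<close> at 0 is irrelevant.
\<close>

definition realizable :: "'a itself \<Rightarrow> (nat \<Rightarrow> int) \<Rightarrow> bool" where
  "realizable t U \<longleftrightarrow>
     (\<exists>(X :: 'a set) T. T \<in> X \<rightarrow> X \<and>
        (\<forall>n\<ge>1. finite {x \<in> X. (T ^^ n) x = x} \<and>
                int (card {x \<in> X. (T ^^ n) x = x}) = U n))"

end

theory Submission
  imports Defs "HOL-Library.Countable" "HOL-Number_Theory.Residues"
begin

text \<open>
  Points of exact prime period \<open>p\<close> come in orbits of size \<open>p\<close>, so a realizable sequence satisfies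
  \<open>U p \<equiv> U 1\<close> modulo \<open>p\<close>; for \<open>F (n\<^sup>2)\<close> this fails at \<open>p = 5\<close>, because \<open>5\<close> divides \<open>F 25\<close>.

  Conversely, the congruences \<open>U (p ^ k * m) \<equiv> U (p ^ (k - 1) * m)\<close> modulo \<open>p ^ k\<close>
  make the would-be number of points of exact period \<open>n\<close> divisible by \<open>n\<close>, rapid growth makes it
  non-negative, and a disjoint union of cycles then realizes \<open>U\<close>. For \<open>p \<noteq> 5\<close> the congruences
  hold already for \<open>F (n\<^sup>2)\<close>: in the ring \<open>\<int>[phi]\<close> one has \<open>phi ^ p\<^sup>2 \<equiv> phi\<close> modulo \<open>p\<close>,
  and raising this to the power \<open>p ^ (2 * k - 2)\<close> gives a congruence modulo
  \<open>p ^ (2 * k - 1)\<close>. For \<open>p = 5\<close> the power of \<open>5\<close> dividing \<open>N\<close> divides \<open>F N\<close>, and the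
  factor \<open>5\<close> supplies the power missing when \<open>k = 1\<close>.
\<close>

section \<open>Periodic points of prime period\<close>

lemma funpow_fixed_mult:
  assumes "(T ^^ n) x = x"
  shows "(T ^^ (n * k)) x = x"
  using assms by (induction k) (simp_all add: funpow_add)

lemma fixed_point_if_coprime_periods:
  assumes "(T ^^ m) x = x" "(T ^^ n) x = x" "coprime m n" "m \<noteq> 0"
  shows "T x = x"
proof -
  obtain u v where uv: "m * u = n * v + 1"
    using bezout_nat[OF assms(4), of n] assms(3) by auto
  have "x = (T ^^ (m * u)) x"
    using assms(1) by (simp add: funpow_fixed_mult)
  also have "\<dots> = T ((T ^^ (n * v)) x)"
    by (simp add: uv)
  also have "\<dots> = T x"
    using assms(2) by (simp add: funpow_fixed_mult)
  finally show ?thesis by simp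
qed

text \<open>A repetition among these iterates would give \<open>x\<close> a period
  \<open>j - i\<close> strictly between 0 and \<open>p\<close>, hence coprime to \<open>p\<close>,
  and coprime periods force a fixed point.\<close>

lemma card_orbit_prime_period:
  assumes p: "prime p" and x: "(T ^^ p) x = x" and nonfixed: "T x \<noteq> x"
  shows "card ((\<lambda>i. (T ^^ i) x) ` {..<p}) = p"
proof -
  have False if "i < j" "j < p" and eq: "(T ^^ i) x = (T ^^ j) x" for i j
  proof -
    have "x = (T ^^ (p - i + i)) x"
      using x that by simp
    also have "\<dots> = (T ^^ (p - i + j)) x"
      unfolding funpow_add by (simp add: eq)
    also have "p - i + j = (j - i) + p"
      using that by simp
    also have "(T ^^ \<dots>) x = (T ^^ (j - i)) x"
      unfolding funpow_add by (simp add: x)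
    finally have "(T ^^ (j - i)) x = x" by simp
    moreover have "coprime p (j - i)"
      using p that by (intro prime_imp_coprime) (auto dest: dvd_imp_le)
    ultimately show False
      using fixed_point_if_coprime_periods[of p T x "j - i"] x nonfixed p by auto
  qed
  then have "inj_on (\<lambda>i. (T ^^ i) x) {..<p}"
    by (intro inj_onI) (metis lessThan_iff nat_neq_iff)
  then show ?thesis by (simp add: card_image)
qed

text \<open>The points of period \<open>p\<close> that \<open>T\<close> moves split into disjoint
  orbits of size \<open>p\<close>.\<close>

lemma prime_dvd_card_fixed_diff:
  fixes T :: "'a \<Rightarrow> 'a"
  assumes p: "prime p" and T: "T \<in> X \<rightarrow> X" and fin: "finite {x \<in> X. (T ^^ p) x = x}"
  shows "int p dvd int (card {x \<in> X. (T ^^ p) x = x}) - int (card {x \<in> X. T x = x})"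
proof -
  define S where "S = {x \<in> X. (T ^^ p) x = x \<and> T x \<noteq> x}"
  define orb where "orb x = (\<lambda>i. (T ^^ i) x) ` {..<p}" for x
  have p0: "p > 0" using p by (simp add: prime_gt_0_nat)
  have orb_mod: "(T ^^ i) x \<in> orb x" if "(T ^^ p) x = x" for i x
    unfolding orb_def using funpow_mod_eq[OF that, of i] p0
    by (intro image_eqI[of _ _ "i mod p"]) auto
  have step_S: "(T ^^ i) x \<in> S" if x: "x \<in> S" for i x
  proof -
    have "T y \<in> S" if y: "y \<in> S" for y
    proof -
      have "(T ^^ p) (T y) = T y"
        using y by (metis (mono_tags, lifting) S_def funpow_swap1 mem_Collect_eq)
      \<comment> \<open>If \<open>T y\<close> were fixed, all later iterates of \<open>y\<close>
        would equal it, including \<open>(T ^^ p) y = y\<close>.\<close>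
      moreover have False if "T (T y) = T y"
      proof -
        have "(T ^^ n) (T y) = T y" for n
          using that by (induction n) auto
        then have "(T ^^ Suc n) y = T y" for n
          by (simp only: funpow_Suc_right o_apply)
        then have "y = T y"
          using y p0 by (metis (mono_tags, lifting) S_def Suc_pred mem_Collect_eq)
        then show False using y by (simp add: S_def)
      qed
      ultimately show ?thesis using y T by (auto simp: S_def)
    qed
    then show ?thesis using x by (induction i) auto
  qed
  have orb_eq: "orb y = orb x" if x: "x \<in> S" and y: "y \<in> orb x" for x y
  proof -
    obtain i where i: "i < p" "y = (T ^^ i) x" using y by (auto simp: orb_def)
    have px: "(T ^^ p) x = x" and py: "(T ^^ p) y = y"
      using x step_S[OF x, of i] i by (auto simp: S_def)
    \<comment> \<open>Another \<open>p - i\<close> steps from \<open>y\<close> close the cycle at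
      \<open>x\<close>, so each orbit contains the other.\<close>
    have "(T ^^ (p - i)) y = (T ^^ (p - i + i)) x"
      unfolding i(2) funpow_add by simp
    then have xy: "x = (T ^^ (p - i)) y"
      using i(1) px by simp
    have "(T ^^ k) y \<in> orb x" for k
      using orb_mod[OF px, of "k + i"] by (simp add: i(2) funpow_add)
    moreover have "(T ^^ k) x \<in> orb y" for k
      using orb_mod[OF py, of "k + (p - i)"] xy by (simp add: funpow_add)
    ultimately show ?thesis by (auto simp: orb_def)
  qed
  have self: "x \<in> orb x" for x
    unfolding orb_def using p0 by (intro image_eqI[of _ _ 0]) auto
  have union: "\<Union>(orb ` S) = S"
    using self step_S by (auto simp: orb_def)
  have "finite S"
    using fin by (rule rev_finite_subset) (auto simp: S_def)
  have "p dvd card (\<Union>(orb ` S))"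
  proof (rule dvd_partition)
    show "finite (\<Union>(orb ` S))" using union \<open>finite S\<close> by simp
    show "\<forall>c\<in>orb ` S. p dvd card c"
      by (auto simp: orb_def S_def card_orbit_prime_period[OF p])
    show "\<forall>c1\<in>orb ` S. \<forall>c2\<in>orb ` S. c1 \<noteq> c2 \<longrightarrow> c1 \<inter> c2 = {}"
      using orb_eq by (metis (no_types, lifting) disjoint_iff imageE)
  qed
  then have "p dvd card S" by (simp add: union)
  moreover have "{x \<in> X. (T ^^ p) x = x} = S \<union> {x \<in> X. T x = x}"
  proof -
    have "(T ^^ p) x = x" if "T x = x" for x
      using that by (induction p) auto
    then show ?thesis by (auto simp: S_def)
  qed
  then have "card {x \<in> X. (T ^^ p) x = x} = card S + card {x \<in> X. T x = x}"
    using fin by (auto simp: S_def intro!: card_Un_disjoint)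
  ultimately show ?thesis by simp
qed

section \<open>A realizability criterion\<close>

lemma realizable_nat_if_countable:
  assumes "realizable TYPE('a::countable) U"
  shows "realizable TYPE(nat) U"
proof -
  obtain X and T :: "'a \<Rightarrow> 'a" where T: "T \<in> X \<rightarrow> X"
    and U: "\<And>n. n \<ge> 1 \<Longrightarrow> finite {x \<in> X. (T ^^ n) x = x} \<and>
      int (card {x \<in> X. (T ^^ n) x = x}) = U n"
    using assms by (auto simp: realizable_def)
  define T' where "T' = (to_nat :: 'a \<Rightarrow> nat) \<circ> T \<circ> from_nat"
  have pow: "(T' ^^ n) (to_nat x) = to_nat ((T ^^ n) x)" for n x
    by (induction n) (auto simp: T'_def)
  have "{y \<in> to_nat ` X. (T' ^^ n) y = y} = to_nat ` {x \<in> X. (T ^^ n) x = x}" for n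
    by (auto simp: pow)
  then have "\<forall>n\<ge>1. finite {y \<in> to_nat ` X. (T' ^^ n) y = y} \<and>
      int (card {y \<in> to_nat ` X. (T' ^^ n) y = y}) = U n"
    using U by (simp add: card_image inj_on_subset[OF inj_to_nat])
  moreover have "T' \<in> to_nat ` X \<rightarrow> to_nat ` X"
    using T by (auto simp: T'_def)
  ultimately show ?thesis unfolding realizable_def by blast
qed

text \<open>The model has \<open>a d\<close> disjoint cycles of each length \<open>d\<close>;
  \<open>(d, i, j)\<close> is position \<open>j\<close> on the \<open>i\<close>-th of them.
  \<open>T ^^ n\<close> fixes all \<open>d\<close> points of such a cycle if \<open>d dvd n\<close>,
  and none otherwise.\<close>

lemma realizable_orbit_sums:
  fixes a :: "nat \<Rightarrow> nat"
  shows "realizable TYPE(nat) (\<lambda>n. \<Sum>d | d dvd n. int (d * a d))"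
proof (rule realizable_nat_if_countable)
  define X where "X = {(d, i, j). 1 \<le> d \<and> i < a d \<and> j < d}"
  define T where "T = (\<lambda>(d :: nat, i :: nat, j :: nat). (d, i, (j + 1) mod d))"
  have T: "T \<in> X \<rightarrow> X" by (auto simp: T_def X_def)
  have pow: "(T ^^ n) (d, i, j) = (d, i, (j + n) mod d)" if "j < d" for n d i j
    using that by (induction n) (auto simp: T_def mod_Suc_eq)
  have "finite {x \<in> X. (T ^^ n) x = x} \<and>
    int (card {x \<in> X. (T ^^ n) x = x}) = (\<Sum>d | d dvd n. int (d * a d))" if n: "n \<ge> 1" for n
  proof -
    have *: "(j + n) mod d = j \<longleftrightarrow> d dvd n" if "j < d" for j d
    proof -
      have "(j + n) mod d = j \<longleftrightarrow> [j + n = j + 0] (mod d)"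
        using that by (simp add: cong_def)
      also have "\<dots> \<longleftrightarrow> d dvd n"
        by (simp only: cong_add_lcancel_nat cong_0_iff)
      finally show ?thesis .
    qed
    have "{x \<in> X. (T ^^ n) x = x} = (SIGMA d:{d. d dvd n}. {..<a d} \<times> {..<d})"
      using n by (auto simp: X_def pow * intro: Suc_leI dvd_pos_nat)
    moreover have "finite {d. d dvd n}" using n by simp
    ultimately show ?thesis
      by (simp add: mult.commute)
  qed
  with T show "realizable TYPE(nat \<times> nat \<times> nat) (\<lambda>n. \<Sum>d | d dvd n. int (d * a d))"
    unfolding realizable_def by blast
qed

text \<open>The number of points of exact period \<open>n\<close>, that is the Moebius transform of \<open>U\<close>.\<close>

fun exact_count :: "(nat \<Rightarrow> int) \<Rightarrow> nat \<Rightarrow> int" where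
  "exact_count U n = U n - (\<Sum>d | d dvd n \<and> d < n. exact_count U d)"

declare exact_count.simps [simp del]

lemma sum_exact:
  assumes "n > 0"
  shows "(\<Sum>d | d dvd n. exact_count U d) = U n"
proof -
  have "{d. d dvd n} = insert n {d. d dvd n \<and> d < n}"
    using assms by (auto dest: dvd_imp_le simp: order_le_less)
  then show ?thesis
    using assms by (simp add: exact_count.simps[of U n])
qed

text \<open>The divisors of \<open>p ^ k * m\<close> that do not divide \<open>p ^ (k - 1) * m\<close> are the
  \<open>p ^ k * e\<close> with \<open>e dvd m\<close>, so the Gauss congruence is a statement about the sum of
  \<^term>\<open>exact_count U\<close> over these.\<close>

lemma dvd_exact:
  assumes gauss: "\<And>p k m. prime p \<Longrightarrow> k \<ge> 1 \<Longrightarrow> \<not> p dvd m \<Longrightarrow>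
      int (p ^ k) dvd U (p ^ k * m) - U (p ^ (k - 1) * m)"
    and "n > 0"
  shows "int n dvd exact_count U n"
  using \<open>n > 0\<close>
proof (induction n rule: less_induct)
  case (less n)
  have prime_power: "int (p ^ multiplicity p n) dvd exact_count U n" if p: "prime p" for p
  proof (cases "p dvd n")
    case True
    define k where "k = multiplicity p n"
    obtain m where m: "n = p ^ k * m" "\<not> p dvd m"
      using multiplicity_decompose'[of n p] less.prems p unfolding k_def
      by (metis not_prime_unit neq0_conv)
    have k: "k \<ge> 1"
      using True p less.prems by (simp add: k_def Suc_le_eq prime_multiplicity_gt_zero_iff)
    have m0: "m > 0" and p0: "p > 0"
      using m less.prems p by (auto simp: prime_gt_0_nat)
    define E where "E = (\<lambda>e. p ^ k * e) ` {e. e dvd m}"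
    have finE: "finite E" using m0 by (simp add: E_def)
    have disj: "{d. d dvd p ^ (k - 1) * m} \<inter> E = {}"
    proof -
      have False if "p ^ k * e dvd p ^ (k - 1) * m" for e
      proof -
        have "p ^ (k - 1) * p dvd p ^ (k - 1) * m"
          using that k by (metis dvd_mult_left power_minus_mult Suc_le_eq One_nat_def)
        then show False using m(2) p0 by simp
      qed
      then show ?thesis by (auto simp: E_def)
    qed
    have union: "{d. d dvd n} = {d. d dvd p ^ (k - 1) * m} \<union> E"
    proof (intro equalityI subsetI)
      fix d assume "d \<in> {d. d dvd n}"
      then have "d dvd p ^ k * m" using m by simp
      then obtain u v where uv: "d = u * v" "u dvd p ^ k" "v dvd m"
        by (rule dvd_productE)
      obtain i where i: "i \<le> k" "u = p ^ i"
        using uv(2) p by (auto simp: divides_primepow_nat)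
      show "d \<in> {d. d dvd p ^ (k - 1) * m} \<union> E"
      proof (cases "i = k")
        case True
        then show ?thesis using uv i by (auto simp: E_def)
      next
        case False
        then show ?thesis using uv i by (auto intro!: mult_dvd_mono le_imp_power_dvd)
      qed
    next
      fix d assume "d \<in> {d. d dvd p ^ (k - 1) * m} \<union> E"
      moreover have "p ^ (k - 1) * m dvd n"
        unfolding m(1) by (intro mult_dvd_mono le_imp_power_dvd) auto
      ultimately show "d \<in> {d. d dvd n}"
        using m(1) by (auto simp: E_def intro: dvd_trans)
    qed
    have n': "p ^ (k - 1) * m > 0" using p0 m0 by simp
    have "U n = U (p ^ (k - 1) * m) + sum (exact_count U) E"
    proof -
      have "U n = sum (exact_count U) ({d. d dvd p ^ (k - 1) * m} \<union> E)"
        using sum_exact[OF less.prems, of U] by (simp add: union)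
      also have "\<dots> = (\<Sum>d | d dvd p ^ (k - 1) * m. exact_count U d) + sum (exact_count U) E"
        using n' finE disj by (intro sum.union_disjoint) auto
      finally show ?thesis by (simp only: sum_exact[OF n'])
    qed
    moreover have "n \<in> E" using m by (auto simp: E_def)
    ultimately have "exact_count U n = (U n - U (p ^ (k - 1) * m)) - sum (exact_count U) (E - {n})"
      using finE by (simp add: sum.remove)
    \<comment> \<open>The other members of \<open>E\<close> are proper divisors of \<open>n\<close>
      and multiples of \<open>p ^ k\<close>, so the induction hypothesis covers them.\<close>
    moreover have "int (p ^ k) dvd sum (exact_count U) (E - {n})"
    proof (rule dvd_sum)
      fix d assume d: "d \<in> E - {n}"
      then have "d dvd n" "d \<noteq> n" using union by auto
      then have "d < n" "d > 0"
        using less.prems by (auto intro: dvd_pos_nat dest: dvd_imp_le)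
      then have "int d dvd exact_count U d" by (rule less.IH)
      moreover have "int (p ^ k) dvd int d"
        using d by (auto simp: E_def)
      ultimately show "int (p ^ k) dvd exact_count U d" by (rule dvd_trans[rotated])
    qed
    moreover have "int (p ^ k) dvd U n - U (p ^ (k - 1) * m)"
      using gauss[OF p k m(2)] m(1) by simp
    ultimately show ?thesis unfolding k_def by (metis dvd_diff)
  next
    case False
    then show ?thesis by (simp add: not_dvd_imp_multiplicity_0)
  qed
  have "n dvd nat \<bar>exact_count U n\<bar>"
  proof (cases "exact_count U n = 0")
    case False
    show ?thesis
    proof (rule multiplicity_le_imp_dvd)
      fix p :: nat assume p: "prime p"
      have "p ^ multiplicity p n dvd nat \<bar>exact_count U n\<bar>"
        using prime_power[OF p] by (simp flip: int_dvd_int_iff)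
      then show "multiplicity p n \<le> multiplicity p (nat \<bar>exact_count U n\<bar>)"
        using p False by (intro multiplicity_geI) (auto simp: not_prime_unit)
    qed (use less.prems in auto)
  qed simp
  then show ?case by (simp flip: int_dvd_int_iff)
qed

text \<open>Inductively \<open>0 <= exact_count U d <= U d\<close> below \<open>n\<close>, so the
  sum subtracted from \<open>U n\<close> is at most the sum of all earlier terms.\<close>

lemma exact_nonneg:
  assumes growth: "\<And>n. n \<ge> 1 \<Longrightarrow> (\<Sum>d=1..<n. U d) \<le> U n" and "n > 0"
  shows "exact_count U n \<ge> 0"
  using \<open>n > 0\<close>
proof (induction n rule: less_induct)
  case (less n)
  have le: "0 \<le> exact_count U d \<and> exact_count U d \<le> U d" if d: "0 < d" "d < n" for d
  proof -
    have "sum (exact_count U) {d} \<le> (\<Sum>e | e dvd d. exact_count U e)"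
    proof (rule sum_mono2)
      fix e assume "e \<in> {e. e dvd d} - {d}"
      then have "0 < e" "e < n"
        using d by (auto intro: dvd_pos_nat dest: dvd_imp_le)
      then show "0 \<le> exact_count U e" by (rule less.IH[rotated])
    qed (use d in auto)
    then show ?thesis using less.IH d by (simp add: sum_exact)
  qed
  have sub: "{d. d dvd n \<and> d < n} \<subseteq> {1..<n}"
    using less.prems by (auto simp: Suc_le_eq intro: dvd_pos_nat)
  have "(\<Sum>d | d dvd n \<and> d < n. exact_count U d) \<le> (\<Sum>d | d dvd n \<and> d < n. U d)"
    using sub le by (intro sum_mono) auto
  also have "\<dots> \<le> (\<Sum>d=1..<n. U d)"
    using sub le by (intro sum_mono2) (auto simp: Suc_le_eq intro: order_trans)
  also have "\<dots> \<le> U n"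
    using less.prems by (intro growth) simp
  finally show ?case by (simp add: exact_count.simps[of U n])
qed

lemma realizable_if_gauss_congruences:
  assumes gauss: "\<And>p k m. prime p \<Longrightarrow> k \<ge> 1 \<Longrightarrow> \<not> p dvd m \<Longrightarrow>
      int (p ^ k) dvd U (p ^ k * m) - U (p ^ (k - 1) * m)"
    and growth: "\<And>n. n \<ge> 1 \<Longrightarrow> (\<Sum>d=1..<n. U d) \<le> U n"
  shows "realizable TYPE(nat) U"
proof -
  define a where "a n = nat (exact_count U n div int n)" for n
  have a: "int (n * a n) = exact_count U n" if n: "n > 0" for n
  proof -
    have "int n dvd exact_count U n" using gauss n by (rule dvd_exact)
    moreover have "exact_count U n \<ge> 0" using growth n by (rule exact_nonneg)
    ultimately show ?thesis
      using n by (simp add: a_def pos_imp_zdiv_nonneg_iff)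
  qed
  have "(\<Sum>d | d dvd n. int (d * a d)) = U n" if n: "n \<ge> 1" for n
  proof -
    have "(\<Sum>d | d dvd n. int (d * a d)) = (\<Sum>d | d dvd n. exact_count U d)"
      using n dvd_pos_nat[of n] by (intro sum.cong refl a) auto
    then show ?thesis using n by (simp add: sum_exact)
  qed
  \<comment> \<open>The two sequences are compared only from index 1 on; at 0 the divisor sum runs
    over an infinite set.\<close>
  then show ?thesis
    using realizable_orbit_sums[of a] by (simp add: realizable_def del: of_nat_mult)
qed

section \<open>The ring of integers of the golden field\<close>

text \<open>\<open>Golden a b\<close> stands for \<open>a + b * phi\<close> where \<open>phi\<^sup>2 = phi + 1\<close>.\<close>

datatype golden = Golden (rat_part: int) (phi_part: int)

instantiation golden :: comm_ring_1
begin

definition "0 = Golden 0 0"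
definition "1 = Golden 1 0"
definition "x + y = Golden (rat_part x + rat_part y) (phi_part x + phi_part y)"
definition "x - y = Golden (rat_part x - rat_part y) (phi_part x - phi_part y)"
definition "- x = Golden (- rat_part x) (- phi_part x)"
definition "x * y = Golden (rat_part x * rat_part y + phi_part x * phi_part y)
  (rat_part x * phi_part y + phi_part x * rat_part y + phi_part x * phi_part y)"

instance
  by standard
    (simp_all add: zero_golden_def one_golden_def plus_golden_def minus_golden_def
      uminus_golden_def times_golden_def golden.expand algebra_simps)

end

lemma golden_parts [simp]:
  "rat_part 0 = 0" "phi_part 0 = 0"
  "rat_part 1 = 1" "phi_part 1 = 0"
  "rat_part (x + y) = rat_part x + rat_part y" "phi_part (x + y) = phi_part x + phi_part y"
  "rat_part (x - y) = rat_part x - rat_part y" "phi_part (x - y) = phi_part x - phi_part y"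
  "rat_part (x * y) = rat_part x * rat_part y + phi_part x * phi_part y"
  "phi_part (x * y) = rat_part x * phi_part y + phi_part x * rat_part y + phi_part x * phi_part y"
  by (simp_all add: zero_golden_def one_golden_def plus_golden_def minus_golden_def
      times_golden_def)

lemma golden_of_nat [simp]: "rat_part (of_nat n) = int n" "phi_part (of_nat n) = 0"
  by (induction n) auto

lemma golden_numeral [simp]: "rat_part (numeral n) = numeral n" "phi_part (numeral n) = 0"
  using golden_of_nat[of "numeral n"] by simp_all

lemma phi_part_dvd:
  assumes "of_nat n dvd (x :: golden)"
  shows "int n dvd phi_part x"
  using assms by auto

abbreviation phi :: golden where "phi \<equiv> Golden 0 1"

lemma phi_part_phi_power: "phi_part (phi ^ n) = int (fib n)"
proof -
  \<comment> \<open>The rational part is the Fibonacci number before \<open>fib n\<close>; adding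
    both parts avoids the index \<open>n - 1\<close>.\<close>
  have "rat_part (phi ^ n) + phi_part (phi ^ n) = int (fib (n + 1)) \<and>
      phi_part (phi ^ n) = int (fib n)"
    by (induction n) auto
  then show ?thesis by simp
qed

section \<open>Congruences for powers of the golden ratio\<close>

lemma prime_dvd_binomial_power_diff:
  fixes x y :: "'a::comm_ring_1"
  assumes p: "prime p"
  shows "of_nat p dvd (x + y) ^ p - (x ^ p + y ^ p)"
proof -
  define f where "f k = of_nat (p choose k) * x ^ k * y ^ (p - k)" for k
  have p1: "p > 1" using p by (rule prime_gt_1_nat)
  have "(x + y) ^ p = (\<Sum>k\<le>p. f k)"
    by (simp add: binomial_ring f_def)
  also have "{..p} = insert 0 (insert p {1..<p})" using p1 by auto
  also have "sum f \<dots> = y ^ p + x ^ p + sum f {1..<p}"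
    using p1 by (simp add: f_def algebra_simps)
  finally have "(x + y) ^ p - (x ^ p + y ^ p) = sum f {1..<p}" by simp
  moreover have "of_nat p dvd f k" if "k \<in> {1..<p}" for k
  proof -
    have "p dvd p choose k" using p that by (intro dvd_choose_prime) auto
    then obtain c where c: "p choose k = p * c" ..
    show ?thesis by (simp add: f_def c mult.assoc)
  qed
  ultimately show ?thesis by (metis dvd_sum)
qed

lemma dvd_power_diff:
  fixes x y :: "'a::comm_ring_1"
  assumes "d dvd x - y"
  shows "d dvd x ^ n - y ^ n"
  using assms by (metis dvd_mult2 power_diff_sumr2)

text \<open>Each \<open>p\<close>-th power gains a factor \<open>p\<close>: the cofactor of
  \<open>X - Y\<close> in \<open>X ^ p - Y ^ p\<close> has \<open>p\<close> terms, all congruent to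
  \<open>Y ^ (p - 1)\<close> modulo \<open>p\<close>.\<close>

lemma prime_power_dvd_power_diff:
  fixes x y :: "'a::comm_ring_1"
  assumes "of_nat p dvd x - y"
  shows "of_nat (p ^ (b + 1)) dvd x ^ (p ^ b) - y ^ (p ^ b)"
proof (induction b)
  case 0
  then show ?case using assms by simp
next
  case (Suc b)
  let ?X = "x ^ p ^ b" and ?Y = "y ^ p ^ b"
  have XY: "of_nat p dvd ?X - ?Y" using assms by (rule dvd_power_diff)
  have "of_nat p dvd ?Y ^ (p - Suc i) * ?X ^ i - ?Y ^ (p - 1)" if i: "i < p" for i
  proof -
    have "?Y ^ (p - Suc i) * ?X ^ i - ?Y ^ (p - 1) = ?Y ^ (p - Suc i) * (?X ^ i - ?Y ^ i)"
      using i by (simp add: right_diff_distrib flip: power_add)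
    then show ?thesis using dvd_power_diff[OF XY, of i] by simp
  qed
  then have "of_nat p dvd (\<Sum>i<p. ?Y ^ (p - Suc i) * ?X ^ i - ?Y ^ (p - 1))"
    by (intro dvd_sum) auto
  also have "\<dots> = (\<Sum>i<p. ?Y ^ (p - Suc i) * ?X ^ i) - of_nat p * ?Y ^ (p - 1)"
    by (simp add: sum_subtractf)
  finally have "of_nat p dvd (\<Sum>i<p. ?Y ^ (p - Suc i) * ?X ^ i)"
    using dvd_diff_left_iff[OF dvd_triv_left] by blast
  with Suc.IH have "of_nat (p ^ (b + 1)) * of_nat p dvd
      (?X - ?Y) * (\<Sum>i<p. ?Y ^ (p - Suc i) * ?X ^ i)"
    by (rule mult_dvd_mono)
  also have "\<dots> = ?X ^ p - ?Y ^ p" by (simp add: power_diff_sumr2)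
  finally show ?case by (simp add: mult.commute flip: power_mult)
qed

lemma frobenius_square_add:
  fixes x y :: "'a::comm_ring_1"
  assumes p: "prime p"
  shows "of_nat p dvd (x + y) ^ p\<^sup>2 - (x ^ p\<^sup>2 + y ^ p\<^sup>2)"
proof -
  have "of_nat p dvd ((x + y) ^ p) ^ p - (x ^ p + y ^ p) ^ p"
    using p by (intro dvd_power_diff prime_dvd_binomial_power_diff)
  moreover have "of_nat p dvd (x ^ p + y ^ p) ^ p - ((x ^ p) ^ p + (y ^ p) ^ p)"
    using p by (rule prime_dvd_binomial_power_diff)
  ultimately have "of_nat p dvd ((x + y) ^ p) ^ p - (x ^ p + y ^ p) ^ p +
      ((x ^ p + y ^ p) ^ p - ((x ^ p) ^ p + (y ^ p) ^ p))"
    by (rule dvd_add)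
  then have "of_nat p dvd ((x + y) ^ p) ^ p - ((x ^ p) ^ p + (y ^ p) ^ p)"
    by (simp only: add_diff_eq diff_add_cancel)
  then show ?thesis by (simp only: power2_eq_square power_mult)
qed

text \<open>Frobenius applied twice to \<open>phi + phi = 1 + sqrt 5\<close>: the square root is fixed modulo \<open>p\<close>
  because \<open>5 ^ ((p\<^sup>2 - 1) / 2)\<close> is a power of \<open>5 ^ (p - 1)\<close>.\<close>

lemma phi_power_prime_square:
  assumes p: "prime p" and "p \<noteq> 5"
  shows "of_nat p dvd phi ^ p\<^sup>2 - phi"
proof (cases "p = 2")
  case True
  have "phi ^ p\<^sup>2 - phi = of_nat p * (phi + 1)"
    by (simp add: True golden.expand power4_eq_xxxx)
  then show ?thesis by simp
next
  case False
  then obtain r where r: "p = 2 * r + 1"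
    using p prime_odd_nat[of p] prime_ge_2_nat[of p] by (auto elim: oddE)
  \<comment> \<open>\<open>s = 2 * phi - 1\<close> is the square root of 5.\<close>
  define s where "s = Golden (- 1) 2"
  have s2: "s\<^sup>2 = of_nat 5" by (simp add: s_def golden.expand power2_eq_square)
  have "\<not> p dvd 5"
    using p \<open>p \<noteq> 5\<close> primes_dvd_imp_eq[of p 5] by auto
  have "[5 ^ (p - 1) = 1] (mod p)"
    using p \<open>\<not> p dvd 5\<close> by (rule fermat_theorem)
  then have "[(5 ^ (p - 1)) ^ (r + 1) = 1 ^ (r + 1)] (mod p)"
    by (rule cong_pow)
  then have "[int (5 ^ ((p - 1) * (r + 1))) = int 1] (mod int p)"
    by (simp only: cong_int_iff power_mult power_one)
  then have "int p dvd 5 ^ ((p - 1) * (r + 1)) - 1"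
    by (simp only: cong_iff_dvd_diff of_nat_power of_nat_1 of_nat_numeral)
  then obtain c where c: "5 ^ ((p - 1) * (r + 1)) - 1 = int p * c" ..
  have "s ^ p\<^sup>2 - s = s * ((s\<^sup>2) ^ ((p - 1) * (r + 1)) - 1)"
  proof -
    \<comment> \<open>This is \<open>(p - 1) * (p + 1)\<close> with
      \<open>p + 1 = 2 * (r + 1)\<close>.\<close>
    have "p\<^sup>2 = Suc (2 * ((p - 1) * (r + 1)))"
      by (simp add: r power2_eq_square algebra_simps)
    then have "s ^ p\<^sup>2 = s * (s\<^sup>2) ^ ((p - 1) * (r + 1))"
      by (simp only: power_Suc power_mult)
    then show ?thesis by (simp only: right_diff_distrib mult_1_right)
  qed
  also have "(s\<^sup>2) ^ ((p - 1) * (r + 1)) - 1 = of_int (5 ^ ((p - 1) * (r + 1)) - 1)"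
    by (simp add: s2)
  also have "\<dots> = of_nat p * of_int c" by (simp only: c of_int_mult of_int_of_nat_eq)
  finally have s: "of_nat p dvd s ^ p\<^sup>2 - s" by simp
  have s1: "of_nat p dvd (1 + s) ^ p\<^sup>2 - (1 + s ^ p\<^sup>2)"
    using frobenius_square_add[OF p, of 1 s] by simp
  have phi2: "of_nat p dvd (phi + phi) ^ p\<^sup>2 - (phi ^ p\<^sup>2 + phi ^ p\<^sup>2)"
    using p by (rule frobenius_square_add)
  have phis: "1 + s = phi + phi" by (simp add: s_def golden.expand)
  have "of_nat p dvd
      ((1 + s) ^ p\<^sup>2 - (1 + s ^ p\<^sup>2)) + (s ^ p\<^sup>2 - s) -
      ((phi + phi) ^ p\<^sup>2 - (phi ^ p\<^sup>2 + phi ^ p\<^sup>2))"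
    by (intro dvd_diff[OF dvd_add] s s1 phi2)
  also have "\<dots> = (phi ^ p\<^sup>2 + phi ^ p\<^sup>2) - (1 + s)"
    unfolding phis[symmetric] by (simp add: algebra_simps)
  also have "\<dots> = 2 * (phi ^ p\<^sup>2 - phi)"
    unfolding phis by (simp add: algebra_simps)
  \<comment> \<open>The factor 2 is cancelled using \<open>p - 2 * r = 1\<close>.\<close>
  finally have "of_nat p dvd of_nat p * (phi ^ p\<^sup>2 - phi) - of_nat r * (2 * (phi ^ p\<^sup>2 - phi))"
    by (rule dvd_diff[OF dvd_triv_left dvd_mult])
  also have "\<dots> = phi ^ p\<^sup>2 - phi"
    by (simp add: r algebra_simps)
  finally show ?thesis .
qed

section \<open>Gauss congruences for Fibonacci numbers at squares\<close>

lemma fib_square_congruence: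
  assumes p: "prime p" "p \<noteq> 5" and k: "k \<ge> 1"
  shows "int (p ^ k) dvd int (fib ((p ^ k * m)\<^sup>2)) - int (fib ((p ^ (k - 1) * m)\<^sup>2))"
proof -
  \<comment> \<open>\<open>p ^ ?b\<close> is the square of \<open>p ^ (k - 1)\<close>, and the
    resulting modulus has exponent \<open>2 * k - 1 >= k\<close>.\<close>
  let ?b = "2 * (k - 1)"
  have "of_nat (p ^ (?b + 1)) dvd (phi ^ p\<^sup>2) ^ (p ^ ?b) - phi ^ (p ^ ?b)"
    using p by (intro prime_power_dvd_power_diff phi_power_prime_square)
  then have "of_nat (p ^ (?b + 1)) dvd
      ((phi ^ p\<^sup>2) ^ (p ^ ?b)) ^ m\<^sup>2 - (phi ^ (p ^ ?b)) ^ m\<^sup>2"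
    by (rule dvd_power_diff)
  moreover have "p\<^sup>2 * p ^ ?b = p ^ (2 * k)"
    using k by (cases k) (simp_all add: power2_eq_square)
  ultimately have "of_nat (p ^ (?b + 1)) dvd
      phi ^ ((p ^ k * m)\<^sup>2) - phi ^ ((p ^ (k - 1) * m)\<^sup>2)"
    by (simp add: power_mult_distrib mult.commute flip: power_mult)
  then have "int (p ^ (?b + 1)) dvd
      int (fib ((p ^ k * m)\<^sup>2)) - int (fib ((p ^ (k - 1) * m)\<^sup>2))"
    by (metis phi_part_dvd phi_part_phi_power golden_parts(8))
  moreover have "int (p ^ k) dvd int (p ^ (?b + 1))"
    unfolding of_nat_power using k by (intro le_imp_power_dvd) simp
  ultimately show ?thesis by (rule dvd_trans[rotated])
qed

text \<open>Expanding the fifth power of \<open>a + b * phi\<close>, the coefficients of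
  \<open>phi\<close> are binomials divisible by 5, except for \<open>b ^ 5\<close>, whose
  coefficient is \<open>fib 5 = 5\<close>.\<close>

lemma five_fib_dvd: "5 * fib n dvd fib (5 * n)"
proof -
  have *: "phi_part (x ^ 5) = (5 * phi_part x) *
      (rat_part x ^ 4 + 2 * rat_part x ^ 3 * phi_part x + 4 * rat_part x ^ 2 * phi_part x ^ 2
        + 3 * rat_part x * phi_part x ^ 3 + phi_part x ^ 4)" for x
    by (simp add: eval_nat_numeral algebra_simps)
  have "5 * phi_part (phi ^ n) dvd phi_part ((phi ^ n) ^ 5)"
    unfolding * by (rule dvd_triv_left)
  then have "int (5 * fib n) dvd int (fib (5 * n))"
    by (simp add: phi_part_phi_power mult.commute flip: power_mult)
  then show ?thesis by (simp only: int_dvd_int_iff)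
qed

lemma five_power_dvd_fib: "5 ^ a dvd fib (5 ^ a * j)"
proof (induction a)
  case (Suc a)
  have "5 * 5 ^ a dvd 5 * fib (5 ^ a * j)"
    using Suc.IH by (intro mult_dvd_mono) auto
  also have "\<dots> dvd fib (5 * (5 ^ a * j))" by (rule five_fib_dvd)
  finally show ?case by (simp add: mult.assoc)
qed simp

text \<open>Used with \<open>i = k\<close> and \<open>i = k - 1\<close>: at the prime 5 both terms
  of the Gauss congruence vanish modulo \<open>5 ^ k\<close>.\<close>

lemma five_power_dvd_five_fib_square:
  assumes "k \<le> 2 * i + 1"
  shows "int (5 ^ k) dvd 5 * int (fib ((5 ^ i * m)\<^sup>2))"
proof -
  have "5 ^ k dvd (5 :: nat) ^ (2 * i + 1)" using assms by (rule le_imp_power_dvd)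
  also have "\<dots> dvd 5 * fib (5 ^ (2 * i) * m\<^sup>2)"
    using five_power_dvd_fib[of "2 * i" "m\<^sup>2"] by simp
  also have "5 ^ (2 * i) * m\<^sup>2 = (5 ^ i * m)\<^sup>2"
    by (simp add: power_mult_distrib mult.commute flip: power_mult)
  finally show ?thesis by (metis int_dvd_int_iff of_nat_mult of_nat_numeral)
qed

text \<open>The earlier terms together are at most the last one, two copies of \<open>fib N\<close>
  are at most \<open>fib (N + 2)\<close>, and consecutive squares from 1 on differ by more than
  2.\<close>

lemma sum_fib_squares_le:
  assumes "n \<ge> 1"
  shows "(\<Sum>d=1..<n. fib (d\<^sup>2)) \<le> fib (n\<^sup>2)"
  using assms
proof (induction n rule: nat_induct_at_least)
  case (Suc n)
  have "(\<Sum>d=1..<Suc n. fib (d\<^sup>2)) \<le> fib (n\<^sup>2) + fib (n\<^sup>2)"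
    using Suc by simp
  also have "\<dots> \<le> fib (n\<^sup>2 + 2)"
    using fib_mono[of "n\<^sup>2" "n\<^sup>2 + 1"] by simp
  also have "\<dots> \<le> fib ((Suc n)\<^sup>2)"
    using Suc.hyps by (intro fib_mono) (simp add: power2_eq_square)
  finally show ?case .
qed simp

lemma not_realizable_fib_square: "\<not> realizable TYPE('a) (\<lambda>n. int (fib (n\<^sup>2)))"
proof
  assume "realizable TYPE('a) (\<lambda>n. int (fib (n\<^sup>2)))"
  then obtain X and T :: "'a \<Rightarrow> 'a" where T: "T \<in> X \<rightarrow> X"
    and U: "\<And>n. n \<ge> 1 \<Longrightarrow> finite {x \<in> X. (T ^^ n) x = x} \<and>
      int (card {x \<in> X. (T ^^ n) x = x}) = int (fib (n\<^sup>2))"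
    by (auto simp: realizable_def)
  have "int 5 dvd int (card {x \<in> X. (T ^^ 5) x = x}) - int (card {x \<in> X. T x = x})"
    using T U by (intro prime_dvd_card_fixed_diff) auto
  then have "5 dvd int (fib (5\<^sup>2)) - int (fib (1\<^sup>2))"
    using U[of 5] U[of 1] by simp
  moreover have "int 5 dvd int (fib (5\<^sup>2))"
    using five_fib_dvd[of 5] by (simp only: int_dvd_int_iff power2_eq_square) (rule dvd_mult_left)
  ultimately have "(5 :: int) dvd int (fib (1\<^sup>2))"
    by (simp add: dvd_diff_right_iff)
  then show False by simp
qed

theorem theorem1p2:
  shows "\<not> realizable TYPE('a) (\<lambda>n. int (fib (n ^ 2))) \<and>
         realizable TYPE(nat) (\<lambda>n. 5 * int (fib (n ^ 2)))"
proof
  show "realizable TYPE(nat) (\<lambda>n. 5 * int (fib (n ^ 2)))"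
  proof (rule realizable_if_gauss_congruences)
    fix p k m :: nat
    assume p: "prime p" and k: "k \<ge> 1"
    show "int (p ^ k) dvd 5 * int (fib ((p ^ k * m)\<^sup>2)) - 5 * int (fib ((p ^ (k - 1) * m)\<^sup>2))"
    proof (cases "p = 5")
      case True
      show ?thesis
        unfolding True using k by (intro dvd_diff five_power_dvd_five_fib_square) auto
    next
      case False
      then show ?thesis
        using fib_square_congruence[OF p False k, of m]
        by (metis dvd_mult right_diff_distrib)
    qed
  next
    fix n :: nat
    assume "n \<ge> 1"
    then show "(\<Sum>d=1..<n. 5 * int (fib (d\<^sup>2))) \<le> 5 * int (fib (n\<^sup>2))"
      using sum_fib_squares_le[of n] by (simp flip: sum_distrib_left of_nat_sum)
  qed
qed (rule not_realizable_fib_square)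

end
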